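(* Let $(\gamma,\nu):I\to\Delta_1$ be a spacelike Legendre curve with curvature $(m,n)$ such that $\{t\in I:n(t)\ne0\}$ is dense in $I$. If $Inv^\pm(\gamma,s_\pm)$ is a horocyclic involute of $\gamma$, then $(Inv^\pm(\gamma,s_\pm),\nu_I^\pm):I\to\Delta_1$ is a spacelike Legendre curve with curvature $$(m_I^\pm(t),n_I^\pm(t))=\left(-s_\pm(t)(n(t)\pm m(t)),\ n(t)\pm m(t)\right),$$ where $\nu_I^\pm(t)=-s_\pm(t)\gamma(t)-\mu(t)\mp s_\pm(t)\nu(t)$.
   Context: All maps are $C^\infty$; $I\subset\mathbb R$ is an interval; a dot denotes $d/dt$. In every formula with $\pm,\mp$ the upper signs are taken together and the lower signs together. $\mathbb R^3_1$ is $\mathbb R^3$ with $\langle x,y\rangle=-x_1y_1+x_2y_2+x_3y_3$ and $x\wedge y=(-(x_2y_3-x_3y_2),\,x_3y_1-x_1y_3,\,x_1y_2-x_2y_1)$. $H^2=\{x:\langle x,x\rangle=-1,\ x_1>0\}$, $S^2_1=\{x:\langle x,x\rangle=1\}$, $\Delta_1=\{(\nu_1,\nu_2)\in H^2\times S_1^2:\langle\nu_1,\nu_2\rangle=0\}$. A spacelike Legendre curve is a map $(\gamma,\nu):I\to\Delta_1$ with $\langle\dot\gamma,\nu\rangle=0$ on $I$; put $\mu=\gamma\wedge\nu$. Its curvature is the pair $(m,n)$ with $\dot\gamma=m\mu$, $\dot\nu=n\mu$ (then $\dot\mu=m\gamma-n\nu$). Horocyclic involute: $Inv^\pm(\gamma,s_\pm)=\gamma+s_\pm\mu+\frac{s_\pm^2}{2}(\gamma\pm\nu)$,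 where $s_\pm:I\to\mathbb R$ is a solution of the Riccati equation $\dot s_\pm=\frac{m\pm n}{2}s_\pm^2-m$. *)

theory Defs
  imports "HOL-Analysis.Analysis"
begin

text \<open>Lorentz-Minkowski 3-space, of signature (-,+,+).\<close>

definition lorentz :: "real^3 \<Rightarrow> real^3 \<Rightarrow> real" where
  "lorentz x y = - (x$1 * y$1) + x$2 * y$2 + x$3 * y$3"

definition lwedge :: "real^3 \<Rightarrow> real^3 \<Rightarrow> real^3" where
  "lwedge x y = vector [- (x$2 * y$3 - x$3 * y$2),
                        x$3 * y$1 - x$1 * y$3,
                        x$1 * y$2 - x$2 * y$1]"

definition hyperbolic_plane :: "(real^3) set" where
  "hyperbolic_plane = {x. lorentz x x = -1 \<and> x$1 > 0}"

definition de_sitter :: "(real^3) set" where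
  "de_sitter = {x. lorentz x x = 1}"

definition Delta1 :: "((real^3) \<times> (real^3)) set" where
  "Delta1 = {(x, y) \<in> hyperbolic_plane \<times> de_sitter. lorentz x y = 0}"

text \<open>
  Derivatives are taken within the parameter interval \<open>I\<close>, hence they are one-sided at those
  endpoints that belong to \<open>I\<close>. They are meaningful only for nondegenerate \<open>I\<close>.
\<close>

definition deriv_within :: "real set \<Rightarrow> (real \<Rightarrow> 'a::real_normed_vector) \<Rightarrow> real \<Rightarrow> 'a" where
  "deriv_within I f t = vector_derivative f (at t within I)"

definition smooth_on :: "real set \<Rightarrow> (real \<Rightarrow> 'a::real_normed_vector) \<Rightarrow> bool" where
  "smooth_on I f \<longleftrightarrow> (\<forall>k::nat. ((deriv_within I ^^ k) f) differentiable_on I)"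

definition spacelike_legendre_curve ::
    "real set \<Rightarrow> (real \<Rightarrow> real^3) \<Rightarrow> (real \<Rightarrow> real^3) \<Rightarrow> bool" where
  "spacelike_legendre_curve I \<gamma> \<nu> \<longleftrightarrow>
     smooth_on I \<gamma> \<and> smooth_on I \<nu> \<and>
     (\<forall>t\<in>I. (\<gamma> t, \<nu> t) \<in> Delta1) \<and>
     (\<forall>t\<in>I. lorentz (deriv_within I \<gamma> t) (\<nu> t) = 0)"

definition is_curvature ::
    "real set \<Rightarrow> (real \<Rightarrow> real^3) \<Rightarrow> (real \<Rightarrow> real^3) \<Rightarrow> (real \<Rightarrow> real) \<Rightarrow> (real \<Rightarrow> real) \<Rightarrow> bool" where
  "is_curvature I \<gamma> \<nu> m n \<longleftrightarrow>
     smooth_on I m \<and> smooth_on I n \<and>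
     (\<forall>t\<in>I. deriv_within I \<gamma> t = m t *\<^sub>R lwedge (\<gamma> t) (\<nu> t) \<and>
            deriv_within I \<nu> t = n t *\<^sub>R lwedge (\<gamma> t) (\<nu> t))"

text \<open>
  The parameter \<open>\<epsilon>\<close> is the sign of the involute: \<open>\<epsilon> = 1\<close> selects all upper signs and
  \<open>\<epsilon> = -1\<close> all lower signs.
\<close>

definition riccati_solution ::
    "real \<Rightarrow> real set \<Rightarrow> (real \<Rightarrow> real) \<Rightarrow> (real \<Rightarrow> real) \<Rightarrow> (real \<Rightarrow> real) \<Rightarrow> bool" where
  "riccati_solution \<epsilon> I m n s \<longleftrightarrow>
     smooth_on I s \<and>
     (\<forall>t\<in>I. deriv_within I s t = (m t + \<epsilon> * n t) / 2 * (s t)\<^sup>2 - m t)"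

definition horocyclic_involute ::
    "real \<Rightarrow> (real \<Rightarrow> real^3) \<Rightarrow> (real \<Rightarrow> real^3) \<Rightarrow> (real \<Rightarrow> real) \<Rightarrow> real \<Rightarrow> real^3" where
  "horocyclic_involute \<epsilon> \<gamma> \<nu> s t =
     \<gamma> t + s t *\<^sub>R lwedge (\<gamma> t) (\<nu> t) + ((s t)\<^sup>2 / 2) *\<^sub>R (\<gamma> t + \<epsilon> *\<^sub>R \<nu> t)"

definition involute_normal ::
    "real \<Rightarrow> (real \<Rightarrow> real^3) \<Rightarrow> (real \<Rightarrow> real^3) \<Rightarrow> (real \<Rightarrow> real) \<Rightarrow> real \<Rightarrow> real^3" where
  "involute_normal \<epsilon> \<gamma> \<nu> s t =
     - (s t *\<^sub>R \<gamma> t) - lwedge (\<gamma> t) (\<nu> t) - (\<epsilon> * s t) *\<^sub>R \<nu> t"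

end

theory Submission
  imports Defs
begin

text \<open>
  Along a spacelike Legendre curve with \<open>\<mu> = \<gamma> \<and> \<nu>\<close> the frame \<open>(\<gamma>, \<nu>, \<mu>)\<close> is pseudo-orthonormal,
  \<open>\<gamma> \<and> \<mu> = -\<nu>\<close>, \<open>\<mu> \<and> \<nu> = \<gamma>\<close> and \<open>\<mu>' = m\<gamma> - n\<nu>\<close>. Expanding the involute, its normal and their
  derivatives in this frame, and replacing \<open>s'\<close> by the Riccati equation, reduces all the equations to
  polynomial identities in \<open>s\<close>. That the involute stays on the upper sheet is the negativity
  of the discriminant of its first coordinate, a quadratic polynomial in \<open>s\<close>.
\<close>

subsection \<open>Smooth maps on an interval\<close>

text \<open>Smoothness is cut at a finite order because differentiating a product yields products of
  new functions; induction on \<open>N\<close> with the functions left arbitrary absorbs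
  this.\<close>

definition smooth_upto :: "nat \<Rightarrow> real set \<Rightarrow> (real \<Rightarrow> 'a::real_normed_vector) \<Rightarrow> bool" where
  "smooth_upto N I f \<longleftrightarrow> (\<forall>k\<le>N. (deriv_within I ^^ k) f differentiable_on I)"

lemma smooth_on_iff_smooth_upto: "smooth_on I f \<longleftrightarrow> (\<forall>N. smooth_upto N I f)"
  unfolding smooth_on_def smooth_upto_def by blast

lemma smooth_upto_0 [simp]: "smooth_upto 0 I f \<longleftrightarrow> f differentiable_on I"
  by (simp add: smooth_upto_def)

text \<open>Splits off the innermost derivative, not the outermost, so that an induction hypothesis
  applies to \<open>deriv_within I f\<close> as a function in its own right.\<close>

lemma smooth_upto_Suc:
  "smooth_upto (Suc N) I f \<longleftrightarrow> f differentiable_on I \<and> smooth_upto N I (deriv_within I f)"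
proof -
  have "(\<forall>k\<le>Suc N. P k) \<longleftrightarrow> P 0 \<and> (\<forall>k\<le>N. P (Suc k))" for P
    by (metis Suc_le_mono le0 not0_implies_Suc)
  then show ?thesis
    by (simp add: smooth_upto_def funpow_Suc_right del: funpow.simps(2))
qed

lemma smooth_upto_mono: "smooth_upto (Suc N) I f \<Longrightarrow> smooth_upto N I f"
  by (simp add: smooth_upto_def)

lemma deriv_within_cong:
  assumes "t \<in> I" "\<And>t. t \<in> I \<Longrightarrow> f t = g t"
  shows "deriv_within I f t = deriv_within I g t"
proof -
  have "(f has_vector_derivative d) (at t within I) = (g has_vector_derivative d) (at t within I)" for d
    using assms by (metis has_vector_derivative_transform)
  then show ?thesis
    by (simp add: deriv_within_def vector_derivative_def)
qed

text \<open>Derivative rules give equalities only at points of \<open>I\<close>; this carries them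
  under all further derivatives, which also depend on values on \<open>I\<close> alone.\<close>

lemma smooth_upto_cong:
  assumes "\<And>t. t \<in> I \<Longrightarrow> f t = g t" "smooth_upto N I g"
  shows "smooth_upto N I f"
  using assms
proof (induction N arbitrary: f g)
  case 0
  then show ?case
    by (simp add: differentiable_on_def) (metis differentiable_transform_within zero_less_one)
next
  case (Suc N)
  have "f differentiable_on I"
    using Suc.prems by (simp add: smooth_upto_Suc differentiable_on_def)
      (metis differentiable_transform_within zero_less_one)
  moreover have "smooth_upto N I (deriv_within I f)"
    using Suc.prems by (intro Suc.IH[of "deriv_within I f" "deriv_within I g"] deriv_within_cong)
      (auto simp: smooth_upto_Suc)
  ultimately show ?case
    by (simp add: smooth_upto_Suc)
qed

lemma smooth_on_differentiable_on: "smooth_on I f \<Longrightarrow> f differentiable_on I"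
  by (metis smooth_on_iff_smooth_upto smooth_upto_0)

lemma differentiable_on_has_deriv_within:
  assumes "f differentiable_on I" "t \<in> I"
  shows "(f has_vector_derivative deriv_within I f t) (at t within I)"
  using assms by (simp add: deriv_within_def differentiable_on_def vector_derivative_works[symmetric])

context
  fixes I :: "real set"
  assumes interval: "is_interval I" and nondegenerate: "\<exists>a\<in>I. \<exists>b\<in>I. a < b"
begin

text \<open>A connected set with two distinct points has no isolated points. Hence derivatives
  within \<open>I\<close> are unique.\<close>

lemma at_within_interval_ne_bot: "t \<in> I \<Longrightarrow> at t within I \<noteq> bot"
  using connected_imp_perfect[of I t] interval nondegenerate
  by (force simp: is_interval_connected trivial_limit_within)

lemma deriv_within_eq:
  assumes "t \<in> I" "(f has_vector_derivative d) (at t within I)"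
  shows "deriv_within I f t = d"
  unfolding deriv_within_def
  using vector_derivative_within[OF at_within_interval_ne_bot] assms by blast

lemma smooth_upto_add:
  assumes "smooth_upto N I f" "smooth_upto N I g"
  shows "smooth_upto N I (\<lambda>t. f t + g t)"
  using assms
proof (induction N arbitrary: f g)
  case 0
  then show ?case by simp
next
  case (Suc N)
  have "deriv_within I (\<lambda>t. f t + g t) t = deriv_within I f t + deriv_within I g t" if "t \<in> I" for t
    using that Suc.prems by (auto intro!: deriv_within_eq has_vector_derivative_add
      differentiable_on_has_deriv_within simp: smooth_upto_Suc)
  then show ?case
    using Suc by (auto simp: smooth_upto_Suc intro: smooth_upto_cong)
qed

lemma smooth_upto_const: "smooth_upto N I (\<lambda>t. c)"
proof (induction N arbitrary: c)
  case (Suc N)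
  have "deriv_within I (\<lambda>t. c) t = 0" if "t \<in> I" for t
    using that by (auto intro!: deriv_within_eq)
  then show ?case
    using Suc smooth_upto_cong[of I "deriv_within I (\<lambda>t. c)" "\<lambda>t. 0"] by (auto simp: smooth_upto_Suc)
qed auto

text \<open>Leibniz rule: each summand of the derivative pairs one factor with the derivative of the
  other. An abstract \<open>prd\<close> covers real products, scalar multiples and
  \<open>lwedge\<close> at once.\<close>

lemma smooth_upto_bilinear:
  assumes "bounded_bilinear prd" "smooth_upto N I f" "smooth_upto N I g"
  shows "smooth_upto N I (\<lambda>t. prd (f t) (g t))"
  using assms(2,3)
proof (induction N arbitrary: f g)
  case 0
  have "(\<lambda>t. prd (f t) (g t)) differentiable (at t within I)" if "t \<in> I" for t
    by (rule differentiableI_vector,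
        rule bounded_bilinear.has_vector_derivative[OF assms(1)
          differentiable_on_has_deriv_within differentiable_on_has_deriv_within])
      (use that 0 in simp_all)
  then show ?case
    by (simp add: differentiable_on_def)
next
  case (Suc N)
  have deriv: "((\<lambda>t. prd (f t) (g t)) has_vector_derivative
      prd (f t) (deriv_within I g t) + prd (deriv_within I f t) (g t)) (at t within I)"
    if "t \<in> I" for t
    using that Suc.prems by (auto intro!: bounded_bilinear.has_vector_derivative[OF assms(1)]
      differentiable_on_has_deriv_within simp: smooth_upto_Suc)
  have "smooth_upto N I (\<lambda>t. prd (f t) (deriv_within I g t) + prd (deriv_within I f t) (g t))"
    using Suc.prems smooth_upto_mono[OF Suc.prems(1)] smooth_upto_mono[OF Suc.prems(2)]
    by (auto intro!: smooth_upto_add Suc.IH simp: smooth_upto_Suc)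
  then have "smooth_upto N I (deriv_within I (\<lambda>t. prd (f t) (g t)))"
    by (rule smooth_upto_cong[rotated]) (use deriv deriv_within_eq in blast)
  moreover have "(\<lambda>t. prd (f t) (g t)) differentiable_on I"
    using deriv by (auto simp: differentiable_on_def intro: differentiableI_vector)
  ultimately show ?case
    by (simp add: smooth_upto_Suc)
qed

lemma smooth_on_add: "smooth_on I f \<Longrightarrow> smooth_on I g \<Longrightarrow> smooth_on I (\<lambda>t. f t + g t)"
  by (simp add: smooth_on_iff_smooth_upto smooth_upto_add)

lemma smooth_on_const: "smooth_on I (\<lambda>t. c)"
  by (simp add: smooth_on_iff_smooth_upto smooth_upto_const)

lemma smooth_on_bilinear:
  "bounded_bilinear prd \<Longrightarrow> smooth_on I f \<Longrightarrow> smooth_on I g \<Longrightarrow> smooth_on I (\<lambda>t. prd (f t) (g t))"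
  by (simp add: smooth_on_iff_smooth_upto smooth_upto_bilinear)

lemmas smooth_on_mult = smooth_on_bilinear[OF bounded_bilinear_mult]
  and smooth_on_scaleR = smooth_on_bilinear[OF bounded_bilinear_scaleR]

lemma smooth_on_minus:
  fixes f :: "real \<Rightarrow> 'a::real_normed_vector"
  shows "smooth_on I f \<Longrightarrow> smooth_on I (\<lambda>t. - f t)"
  using smooth_on_scaleR[OF smooth_on_const[of "-1"], of f] by simp

lemma smooth_on_diff: "smooth_on I f \<Longrightarrow> smooth_on I g \<Longrightarrow> smooth_on I (\<lambda>t. f t - g t)"
  using smooth_on_add[OF _ smooth_on_minus, of f g] by simp

end

subsection \<open>The wedge product and moving frames\<close>

lemma lwedge_nth [simp]:
  "lwedge x y $ 1 = - (x$2 * y$3 - x$3 * y$2)"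
  "lwedge x y $ 2 = x$3 * y$1 - x$1 * y$3"
  "lwedge x y $ 3 = x$1 * y$2 - x$2 * y$1"
  by (simp_all add: lwedge_def)

text \<open>In finite dimension bilinearity already implies boundedness.\<close>

lemma bounded_bilinear_lwedge: "bounded_bilinear lwedge"
  unfolding bilinear_conv_bounded_bilinear[symmetric] bilinear_def
  by (auto intro!: linearI simp: vec_eq_iff forall_3 algebra_simps)

interpretation lwedge: bounded_bilinear lwedge
  by (rule bounded_bilinear_lwedge)

lemma lwedge_self [simp]: "lwedge x x = 0"
  by (simp add: vec_eq_iff forall_3)

lemma lwedge_commute: "lwedge y x = - lwedge x y"
  by (simp add: vec_eq_iff forall_3)

lemma lorentz_bilinear:
  "lorentz (x + y) z = lorentz x z + lorentz y z"
  "lorentz z (x + y) = lorentz z x + lorentz z y"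
  "lorentz (c *\<^sub>R x) z = c * lorentz x z"
  "lorentz z (c *\<^sub>R x) = c * lorentz z x"
  by (simp_all add: lorentz_def algebra_simps)

lemma lorentz_commute: "lorentz x y = lorentz y x"
  by (simp add: lorentz_def mult.commute)

lemma lorentz_lwedge [simp]: "lorentz x (lwedge x y) = 0" "lorentz y (lwedge x y) = 0"
  by (simp_all add: lorentz_def algebra_simps)

text \<open>Triple product expansions; compared with the Euclidean cross product the signs are
  reversed.\<close>

lemma lwedge_lwedge:
  "lwedge x (lwedge x y) = lorentz x x *\<^sub>R y - lorentz x y *\<^sub>R x"
  "lwedge (lwedge x y) y = lorentz y y *\<^sub>R x - lorentz x y *\<^sub>R y"
  by (simp_all add: vec_eq_iff forall_3 lorentz_def algebra_simps)

text \<open>Lagrange's identity, again with the sign opposite to the Euclidean one.\<close>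

lemma lorentz_lwedge_lwedge:
  "lorentz (lwedge x y) (lwedge x y) = (lorentz x y)\<^sup>2 - lorentz x x * lorentz y y"
  by (simp add: lorentz_def power2_eq_square algebra_simps)

lemma Delta1_iff:
  "(a, b) \<in> Delta1 \<longleftrightarrow> lorentz a a = -1 \<and> lorentz b b = 1 \<and> lorentz a b = 0 \<and> a $ 1 > 0"
  by (auto simp: Delta1_def hyperbolic_plane_def de_sitter_def)

lemma Delta1_frame:
  assumes "(a, b) \<in> Delta1"
  shows "lwedge a (lwedge a b) = - b" "lwedge (lwedge a b) b = a"
    "lorentz (lwedge a b) (lwedge a b) = 1"
  using assms by (simp_all add: Delta1_iff lwedge_lwedge lorentz_lwedge_lwedge)

text \<open>This is \<open>lorentz e e = -1\<close> for the first unit vector \<open>e\<close>,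
  expanded in the pseudo-orthonormal frame.\<close>

lemma Delta1_first_coordinate:
  assumes "(a, b) \<in> Delta1"
  shows "(a $ 1)\<^sup>2 = 1 + (b $ 1)\<^sup>2 + (lwedge a b $ 1)\<^sup>2"
proof -
  have a: "(a$2)\<^sup>2 + (a$3)\<^sup>2 = (a$1)\<^sup>2 - 1" and b: "(b$2)\<^sup>2 + (b$3)\<^sup>2 = 1 + (b$1)\<^sup>2"
    and ab: "a$2 * b$2 + a$3 * b$3 = a$1 * b$1"
    using assms by (auto simp: Delta1_iff lorentz_def power2_eq_square)
  \<comment> \<open>Planar Lagrange identity for the last two coordinates of \<open>a\<close> and
    \<open>b\<close>.\<close>
  have "(lwedge a b $ 1)\<^sup>2 = ((a$2)\<^sup>2 + (a$3)\<^sup>2) * ((b$2)\<^sup>2 + (b$3)\<^sup>2) - (a$2 * b$2 + a$3 * b$3)\<^sup>2"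
    by (simp add: power2_eq_square algebra_simps)
  then show ?thesis
    unfolding a b ab by (simp add: power2_eq_square algebra_simps)
qed

section \<open>Algebra of the involute and its normal at one parameter value\<close>

context
  fixes a b p q :: "real^3" and r \<epsilon> :: real
  assumes frame: "(a, b) \<in> Delta1" and sign: "\<epsilon> = 1 \<or> \<epsilon> = -1"
    and p: "p = a + r *\<^sub>R lwedge a b + (r\<^sup>2 / 2) *\<^sub>R (a + \<epsilon> *\<^sub>R b)"
    and q: "q = - (r *\<^sub>R a) - lwedge a b - (\<epsilon> * r) *\<^sub>R b"
begin

text \<open>Every term is an added scalar multiple of a frame vector, since
  \<open>lorentz_bilinear\<close> expands only sums and scalings.\<close>

lemma involute_frame_expansion:
  "p = (1 + r\<^sup>2 / 2) *\<^sub>R a + r *\<^sub>R lwedge a b + (\<epsilon> * r\<^sup>2 / 2) *\<^sub>R b"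
  "q = (- r) *\<^sub>R a + (- 1) *\<^sub>R lwedge a b + (- \<epsilon> * r) *\<^sub>R b"
  by (simp_all add: p q algebra_simps)

lemma involute_in_Delta1: "(p, q) \<in> Delta1"
proof -
  have products: "lorentz a a = -1" "lorentz b b = 1" "lorentz a b = 0" "lorentz b a = 0"
    "lorentz (lwedge a b) a = 0" "lorentz (lwedge a b) b = 0"
    using frame by (simp_all add: Delta1_iff lorentz_commute[of b a]
        lorentz_commute[of "lwedge a b" a] lorentz_commute[of "lwedge a b" b])
  have "p $ 1 > 0"
  proof -
    \<comment> \<open>\<open>u\<close> is the first coordinate of the lightlike vector
      \<open>a + \<epsilon> *\<^sub>R b\<close>, and \<open>u / 2\<close> is the leading coefficient
      of \<open>p $ 1\<close> as a quadratic in \<open>r\<close>. Multiplying by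
      \<open>2 * u\<close> completes the square.\<close>
    define u where "u = a $ 1 + \<epsilon> * b $ 1"
    have "\<bar>b $ 1\<bar> < a $ 1"
      using frame Delta1_first_coordinate[OF frame]
      by (intro power2_less_imp_less[of "\<bar>b $ 1\<bar>"]) (auto simp: Delta1_iff add_pos_nonneg)
    then have "u > 0"
      using sign by (auto simp: u_def)
    have "2 * u * (p $ 1) = (r * u + lwedge a b $ 1)\<^sup>2 + 2 * u * a $ 1 - (lwedge a b $ 1)\<^sup>2"
      by (simp add: p u_def power2_eq_square algebra_simps)
    also have "\<dots> = (r * u + lwedge a b $ 1)\<^sup>2 + u\<^sup>2 + 1"
    proof -
      \<comment> \<open>Uses that \<epsilon> squares to 1. With the relation between first
        coordinates, the part free of \<open>r\<close> outside the square becomes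
        \<open>u\<^sup>2 + 1\<close>.\<close>
      have "u\<^sup>2 = 2 * u * a $ 1 - (a $ 1)\<^sup>2 + (b $ 1)\<^sup>2"
        using sign by (auto simp: u_def power2_eq_square algebra_simps)
      then show ?thesis
        using Delta1_first_coordinate[OF frame] by linarith
    qed
    also have "\<dots> > 0"
      by (simp add: add_nonneg_pos)
    finally show ?thesis
      using \<open>u > 0\<close> by (simp add: zero_less_mult_iff)
  qed
  moreover have "lorentz p p = -1" "lorentz q q = 1" "lorentz p q = 0"
    unfolding involute_frame_expansion lorentz_bilinear products Delta1_frame(3)[OF frame] lorentz_lwedge
    using sign by (auto simp: power2_eq_square field_simps)
  ultimately show ?thesis
    by (simp add: Delta1_iff)
qed

text \<open>The third frame vector along the involute, of which both derivatives must turn out to be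
  multiples.\<close>

lemma lwedge_involute:
  "lwedge p q = (- \<epsilon> * r\<^sup>2 / 2) *\<^sub>R a + (- \<epsilon> * r) *\<^sub>R lwedge a b + (1 - r\<^sup>2 / 2) *\<^sub>R b"
proof -
  have wedges: "lwedge (lwedge a b) a = b" "lwedge b (lwedge a b) = - a" "lwedge b a = - lwedge a b"
    using Delta1_frame[OF frame]
    by (simp_all add: lwedge_commute[of "lwedge a b" a] lwedge_commute[of b])
  \<comment> \<open>Of the nine wedge products of frame vectors the three diagonal ones vanish; the
    others are again frame vectors up to sign.\<close>
  have "lwedge p q =
      (r * (- \<epsilon> * r) + \<epsilon> * r\<^sup>2 / 2) *\<^sub>R a
      + ((1 + r\<^sup>2 / 2) * (- \<epsilon> * r) + \<epsilon> * r\<^sup>2 / 2 * r) *\<^sub>R lwedge a b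
      + ((1 + r\<^sup>2 / 2) - r\<^sup>2) *\<^sub>R b"
    unfolding involute_frame_expansion lwedge.add_left lwedge.add_right lwedge.scaleR_left lwedge.scaleR_right
      wedges Delta1_frame[OF frame] lwedge_self
    by (simp add: vec_eq_iff algebra_simps power2_eq_square)
  also have "r * (- \<epsilon> * r) + \<epsilon> * r\<^sup>2 / 2 = - \<epsilon> * r\<^sup>2 / 2"
    by (simp add: power2_eq_square)
  also have "(1 + r\<^sup>2 / 2) * (- \<epsilon> * r) + \<epsilon> * r\<^sup>2 / 2 * r = - \<epsilon> * r"
    by (simp add: algebra_simps)
  also have "(1 + r\<^sup>2 / 2) - r\<^sup>2 = 1 - r\<^sup>2 / 2"
    by simp
  finally show ?thesis .
qed

end

section \<open>Derivatives along the involute\<close>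

theorem proposition4p9:
  fixes I :: "real set" and \<gamma> \<nu> :: "real \<Rightarrow> real^3" and m n s :: "real \<Rightarrow> real" and \<epsilon> :: real
  assumes "is_interval I" and "\<exists>a\<in>I. \<exists>b\<in>I. a < b"
    and "spacelike_legendre_curve I \<gamma> \<nu>"
    and "is_curvature I \<gamma> \<nu> m n"
    and "I \<subseteq> closure {t \<in> I. n t \<noteq> 0}"
    and "\<epsilon> = 1 \<or> \<epsilon> = -1"
    and "riccati_solution \<epsilon> I m n s"
  shows "spacelike_legendre_curve I (horocyclic_involute \<epsilon> \<gamma> \<nu> s) (involute_normal \<epsilon> \<gamma> \<nu> s) \<and>
         is_curvature I (horocyclic_involute \<epsilon> \<gamma> \<nu> s) (involute_normal \<epsilon> \<gamma> \<nu> s)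
           (\<lambda>t. - s t * (n t + \<epsilon> * m t)) (\<lambda>t. n t + \<epsilon> * m t)"
proof -
  define \<mu> where "\<mu> t = lwedge (\<gamma> t) (\<nu> t)" for t
  define P where "P = horocyclic_involute \<epsilon> \<gamma> \<nu> s"
  define Q where "Q = involute_normal \<epsilon> \<gamma> \<nu> s"
  \<comment> \<open>The square is written as a product so that the function matches, term by term,
    the one differentiated in \<open>dP\<close>.\<close>
  have P_eq: "P = (\<lambda>t. \<gamma> t + s t *\<^sub>R \<mu> t + (s t * s t * (1 / 2)) *\<^sub>R (\<gamma> t + \<epsilon> *\<^sub>R \<nu> t))"
    and Q_eq: "Q = (\<lambda>t. - (s t *\<^sub>R \<gamma> t) - \<mu> t - (\<epsilon> * s t) *\<^sub>R \<nu> t)"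
    by (auto simp: P_def Q_def horocyclic_involute_def involute_normal_def \<mu>_def power2_eq_square)
  note I = assms(1,2)
  have smooth: "smooth_on I \<gamma>" "smooth_on I \<nu>" "smooth_on I m" "smooth_on I n" "smooth_on I s"
    using assms by (auto simp: spacelike_legendre_curve_def is_curvature_def riccati_solution_def)
  have "smooth_on I \<mu>"
    unfolding \<mu>_def using smooth by (intro smooth_on_bilinear[OF I bounded_bilinear_lwedge])
  note smooth_intros = smooth this smooth_on_add[OF I] smooth_on_diff[OF I] smooth_on_minus[OF I]
    smooth_on_mult[OF I] smooth_on_scaleR[OF I] smooth_on_const[OF I]
  have smooth_P: "smooth_on I P" and smooth_Q: "smooth_on I Q"
    unfolding P_eq Q_eq by (intro smooth_intros)+
  have smooth_curvature: "smooth_on I (\<lambda>t. - s t * (n t + \<epsilon> * m t))" "smooth_on I (\<lambda>t. n t + \<epsilon> * m t)"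
    by (intro smooth_intros)+
  have pointwise: "(P t, Q t) \<in> Delta1"
      "deriv_within I P t = (- s t * (n t + \<epsilon> * m t)) *\<^sub>R lwedge (P t) (Q t)"
      "deriv_within I Q t = (n t + \<epsilon> * m t) *\<^sub>R lwedge (P t) (Q t)" if t: "t \<in> I" for t
  proof -
    have frame: "(\<gamma> t, \<nu> t) \<in> Delta1"
      using assms(3) t by (simp add: spacelike_legendre_curve_def)
    have P_t: "P t = \<gamma> t + s t *\<^sub>R lwedge (\<gamma> t) (\<nu> t) + ((s t)\<^sup>2 / 2) *\<^sub>R (\<gamma> t + \<epsilon> *\<^sub>R \<nu> t)"
      and Q_t: "Q t = - (s t *\<^sub>R \<gamma> t) - lwedge (\<gamma> t) (\<nu> t) - (\<epsilon> * s t) *\<^sub>R \<nu> t"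
      by (simp_all add: P_def Q_def horocyclic_involute_def involute_normal_def)
    show "(P t, Q t) \<in> Delta1"
      by (rule involute_in_Delta1[OF frame assms(6) P_t Q_t])
    have wedge: "lwedge (P t) (Q t) = (- \<epsilon> * (s t)\<^sup>2 / 2) *\<^sub>R \<gamma> t + (- \<epsilon> * s t) *\<^sub>R \<mu> t + (1 - (s t)\<^sup>2 / 2) *\<^sub>R \<nu> t"
      unfolding \<mu>_def by (rule lwedge_involute[OF frame assms(6) P_t Q_t])
    define s' where "s' = (m t + \<epsilon> * n t) / 2 * (s t)\<^sup>2 - m t"
    have d\<gamma>: "(\<gamma> has_vector_derivative m t *\<^sub>R \<mu> t) (at t within I)"
      and d\<nu>: "(\<nu> has_vector_derivative n t *\<^sub>R \<mu> t) (at t within I)"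
      and ds: "(s has_vector_derivative s') (at t within I)"
      using differentiable_on_has_deriv_within[OF smooth_on_differentiable_on t] smooth assms(4,7) t
      unfolding is_curvature_def riccati_solution_def \<mu>_def s'_def by metis+
    \<comment> \<open>The product rule gives
      \<open>\<gamma> \<and> n\<mu> + m\<mu> \<and> \<nu>\<close>, and the frame relations turn this
      into \<open>m\<gamma> - n\<nu>\<close>.\<close>
    have d\<mu>: "(\<mu> has_vector_derivative m t *\<^sub>R \<gamma> t - n t *\<^sub>R \<nu> t) (at t within I)"
      using lwedge.has_vector_derivative[OF d\<gamma> d\<nu>] Delta1_frame[OF frame]
      by (simp add: \<mu>_def[abs_def] lwedge.scaleR_left lwedge.scaleR_right)
    note dc = has_vector_derivative_const
    note dscale = bounded_bilinear.has_vector_derivative[OF bounded_bilinear_scaleR]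
    note dmult = bounded_bilinear.has_vector_derivative[OF bounded_bilinear_mult]
    note dadd = has_vector_derivative_add and ddiff = has_vector_derivative_diff
      and dminus = has_vector_derivative_minus
    note dP = dadd[OF dadd[OF d\<gamma> dscale[OF ds d\<mu>]]
        dscale[OF dmult[OF dmult[OF ds ds] dc[of "1 / 2"]] dadd[OF d\<gamma> dscale[OF dc[of \<epsilon>] d\<nu>]]]]
    note dQ = ddiff[OF ddiff[OF dminus[OF dscale[OF ds d\<gamma>]] d\<mu>] dscale[OF dmult[OF dc[of \<epsilon>] ds] d\<nu>]]
    \<comment> \<open>By the Riccati equation \<open>m + s'\<close> equals
      \<open>(m + \<epsilon>n) / 2\<close> times the square of \<open>s\<close>, so all coefficients
      acquire the factor \<open>m + \<epsilon>n\<close>, which is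
      \<open>\<epsilon> * (n + \<epsilon>m)\<close>.\<close>
    show "deriv_within I P t = (- s t * (n t + \<epsilon> * m t)) *\<^sub>R lwedge (P t) (Q t)"
      unfolding deriv_within_eq[OF I t dP, folded P_eq] wedge s'_def
      using assms(6) by (auto simp: vec_eq_iff field_simps power2_eq_square)
    show "deriv_within I Q t = (n t + \<epsilon> * m t) *\<^sub>R lwedge (P t) (Q t)"
      unfolding deriv_within_eq[OF I t dQ, folded Q_eq] wedge s'_def
      using assms(6) by (auto simp: vec_eq_iff field_simps power2_eq_square)
  qed
  \<comment> \<open>The derivative of \<open>P\<close> is a multiple of
    \<open>lwedge (P t) (Q t)\<close>, which is orthogonal to \<open>Q t\<close>.\<close>
  have "lorentz (deriv_within I P t) (Q t) = 0" if "t \<in> I" for t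
    unfolding pointwise(2)[OF that] lorentz_bilinear
    by (simp add: lorentz_commute[of "lwedge (P t) (Q t)"])
  then show ?thesis
    unfolding spacelike_legendre_curve_def is_curvature_def P_def[symmetric] Q_def[symmetric]
    using smooth_P smooth_Q smooth_curvature pointwise by blast
qed

end
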